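(* Let $a$ be an integral closed 2-frieze of width $m$, let $1\le k\le m$ and $c\in\mathbb{Z}$, and put $$x=a(k,c),\quad y=a(k,c+1),\quad u=a(k+1,c),\quad v=a(k+1,c+1)$$ (so $x,y$ are adjacent entries of a row and $u$, $v$ are the entries directly below $x$, $y$ respectively). Cutting the two columns $c,c+1$ directly below the pair $x,y$ and placing a pair $1\;1$ under $x,y$ gives an integral closed 2-frieze of width $k$, that is, there is an integral closed 2-frieze $w$ of width $k$ with $w(r,\epsilon)=a(r,c+\epsilon)$ for all $0\le r\le k$ and $\epsilon\in\{0,1\}$, if and only if $$u\equiv 1 \bmod y\qquad\text{and}\qquad v\equiv 1 \bmod x .$$
   Context: A closed 2-frieze of width $m$ is an array $a(r,c)$, with rows $r\in\{0,1,\dots,m+1\}$ (numbered from top to bottom) and columns $c\in\mathbb{Z}$ (numbered from left to right), whose top and bottom rows consist of 1s, i.e. $a(0,c)=a(m+1,c)=1$ for all $c\in\mathbb{Z}$, and which satisfies the local rule $$a(r,c)=a(r,c-1)\,a(r,c+1)-a(r-1,c)\,a(r+1,c)\qquad (1\le r\le m,\ c\in\mathbb{Z}).$$ A closed 2-frieze is integral if all its entries are positive integers. *)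

theory Defs
  imports "HOL-Number_Theory.Cong"
begin

text \<open>Arrays are functions of a row and a column; the values outside rows
  \<open>0, \<dots>, m + 1\<close> are irrelevant and left unconstrained.\<close>

definition closed_2_frieze :: "nat \<Rightarrow> (nat \<Rightarrow> int \<Rightarrow> 'a::comm_ring_1) \<Rightarrow> bool" where
  "closed_2_frieze m a \<longleftrightarrow>
     (\<forall>c. a 0 c = 1 \<and> a (m + 1) c = 1) \<and>
     (\<forall>r c. 1 \<le> r \<and> r \<le> m \<longrightarrow>
        a r c = a r (c - 1) * a r (c + 1) - a (r - 1) c * a (r + 1) c)"

definition integral_closed_2_frieze :: "nat \<Rightarrow> (nat \<Rightarrow> int \<Rightarrow> int) \<Rightarrow> bool" where
  "integral_closed_2_frieze m a \<longleftrightarrow>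
     closed_2_frieze m a \<and> (\<forall>r c. r \<le> m + 1 \<longrightarrow> 0 < a r c)"

end

theory Submission
  imports Defs
begin

text \<open>
  A positive 2-frieze consists of \<open>3 \<times> 3\<close> minors of a sequence of vectors \<open>V\<^sub>l\<close> in which any three
  consecutive vectors have determinant 1: writing \<open>|i j l|\<close> for \<open>det (V\<^sub>i, V\<^sub>j, V\<^sub>l)\<close>, the entries are
  alternately \<open>|p p+1 q|\<close> and \<open>|p q-1 q|\<close>, and the local rule is a Pluecker relation. The sequence
  obeys a recurrence \<open>V\<^bsub>l+3\<^esub> = \<alpha>\<^sub>l V\<^bsub>l+2\<^esub> - \<beta>\<^sub>l V\<^bsub>l+1\<^esub> + V\<^sub>l\<close> whose coefficients are the entries of row 1, so an
  integral frieze has integral vectors. Numbering suitably,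
  \<open>x = |0 1 k+2|\<close>, \<open>y = |1 k+2 k+3|\<close>, \<open>u = |0 k+2 k+3|\<close> and \<open>v = |0 1 k+3|\<close>.

  If \<open>u + t y = 1\<close> and \<open>v + s x = 1\<close>, replace \<open>V\<^sub>0\<close> by \<open>V\<^sub>0 + t V\<^sub>1\<close> and \<open>V\<^bsub>k+3\<^esub>\<close> by \<open>V\<^bsub>k+3\<^esub> + s V\<^bsub>k+2\<^esub>\<close>
  and repeat the \<open>k + 4\<close> vectors periodically: all consecutive determinants are again 1, and in the
  two columns the entries of rows \<open>\<le> k\<close> are unchanged. Positivity propagates from two adjacent
  columns by the local rule.

  Conversely, expanding \<open>V\<^sub>0 = \<beta>\<^sub>0 V\<^sub>1 - \<alpha>\<^sub>0 V\<^sub>2 + V\<^sub>3\<close> in \<open>u\<close> gives \<open>u = \<beta>\<^sub>0 y - \<alpha>\<^sub>0 |2 k+2 k+3| + |3 k+2 k+3|\<close>, where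
  everything except \<open>\<beta>\<^sub>0\<close> is determined by the rows \<open>\<le> k\<close> of the two columns. Hence \<open>u mod y\<close> is the
  same for the given frieze and for the cut one, where \<open>u = 1\<close>. The claim on \<open>v\<close> is its mirror image.
\<close>

section \<open>Friezes of 3 by 3 minors\<close>

definition det3 :: "(nat \<Rightarrow> 'a::comm_ring_1) \<Rightarrow> (nat \<Rightarrow> 'a) \<Rightarrow> (nat \<Rightarrow> 'a) \<Rightarrow> 'a" where
  "det3 u v w = u 0 * (v 1 * w 2 - v 2 * w 1) - u 1 * (v 0 * w 2 - v 2 * w 0)
     + u 2 * (v 0 * w 1 - v 1 * w 0)"

lemma det3_rotate: "det3 u v w = det3 v w u"
  by (simp add: det3_def algebra_simps)

lemma det3_repeated: "det3 u u w = 0"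
  by (simp add: det3_def algebra_simps)

text \<open>All six determinants contain \<open>d\<close>, so this is the three-term Pluecker
  relation for \<open>a\<close>, \<open>b\<close>, \<open>c\<close>, \<open>e\<close> in the
  quotient by \<open>d\<close>. The second version is the first with its factors rotated, as the odd
  case of the local rule needs them.\<close>

lemma det3_plucker:
  "det3 a b d * det3 c d e - det3 a d e * det3 c b d = det3 a c d * det3 b d e"
  "det3 b d a * det3 d e c - det3 d e a * det3 b d c = det3 d a c * det3 b d e"
  by (simp_all add: det3_def algebra_simps)

text \<open>Row \<open>r\<close> has the vectors \<open>V\<^sub>p\<close> and \<open>V\<^sub>q\<close> with \<open>q = p + r + 2\<close> at the outside; the parity of \<open>c - r\<close>
  decides whether the third vector is the successor of \<open>V\<^sub>p\<close> or the predecessor of \<open>V\<^sub>q\<close>.\<close>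

definition det_frieze :: "(int \<Rightarrow> nat \<Rightarrow> 'a::comm_ring_1) \<Rightarrow> nat \<Rightarrow> int \<Rightarrow> 'a" where
  "det_frieze V r c =
     (let p = (c - int r - 1) div 2; q = p + int r + 2
      in det3 (V p) (V (if even (c - int r) then p + 1 else q - 1)) (V q))"

lemma det_frieze_even: "det_frieze V r (2 * p + int r + 2) = det3 (V p) (V (p + 1)) (V (p + int r + 2))"
proof -
  have "(2 * p + int r + 2 - int r - 1) div 2 = p" by linarith
  then show ?thesis by (simp add: det_frieze_def Let_def)
qed

lemma det_frieze_odd:
  "det_frieze V r (2 * p + int r + 1) = det3 (V p) (V (p + int r + 1)) (V (p + int r + 2))"
proof -
  have "(2 * p + int r + 1 - int r - 1) div 2 = p" by linarith
  then show ?thesis by (simp add: det_frieze_def Let_def algebra_simps)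
qed

lemma det_frieze_cases:
  obtains (even) p where "c = 2 * p + int r + 2" | (odd) p where "c = 2 * p + int r + 1"
proof (cases "even (c - int r)")
  case True
  then obtain q where "c - int r = 2 * q" by (elim evenE)
  then have "c = 2 * (q - 1) + int r + 2" by simp
  then show ?thesis by (rule even)
next
  case False
  then obtain q where "c - int r = 2 * q + 1" by (elim oddE)
  then have "c = 2 * q + int r + 1" by simp
  then show ?thesis by (rule odd)
qed

definition unimodular :: "(int \<Rightarrow> nat \<Rightarrow> 'a::comm_ring_1) \<Rightarrow> bool" where
  "unimodular V \<longleftrightarrow> (\<forall>l. det3 (V l) (V (l + 1)) (V (l + 2)) = 1)"

lemma det_frieze_0:
  assumes "unimodular V"
  shows "det_frieze V 0 c = 1"
proof (cases rule: det_frieze_cases[of c 0])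
  case (even p)
  then show ?thesis using assms det_frieze_even[of V 0 p] by (simp add: unimodular_def)
next
  case (odd p)
  then show ?thesis using assms det_frieze_odd[of V 0 p] by (simp add: unimodular_def)
qed

lemma det_frieze_rule:
  assumes "unimodular V" "1 \<le> r"
  shows "det_frieze V r c =
    det_frieze V r (c - 1) * det_frieze V r (c + 1) - det_frieze V (r - 1) c * det_frieze V (r + 1) c"
proof -
  have u: "det3 (V l) (V (l + 1)) (V (l + 2)) = 1" for l
    using assms by (simp add: unimodular_def)
  show ?thesis
  proof (cases rule: det_frieze_cases[of c r])
    case (even p)
    let ?q = "p + int r + 2"
    have "det_frieze V r c = det3 (V p) (V (p + 1)) (V ?q)"
      using even det_frieze_even[of V r p] by simp
    moreover have "det_frieze V r (c - 1) = det3 (V p) (V (?q - 1)) (V ?q)"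
      using even det_frieze_odd[of V r p] by (simp add: algebra_simps)
    moreover have "det_frieze V r (c + 1) = det3 (V (p + 1)) (V ?q) (V (?q + 1))"
      using even det_frieze_odd[of V r "p + 1"] by (simp add: algebra_simps)
    moreover have "det_frieze V (r - 1) c = det3 (V (p + 1)) (V (?q - 1)) (V ?q)"
      using even assms(2) det_frieze_odd[of V "r - 1" "p + 1"] by (simp add: algebra_simps)
    moreover have "det_frieze V (r + 1) c = det3 (V p) (V ?q) (V (?q + 1))"
      using even det_frieze_odd[of V "r + 1" p] by (simp add: algebra_simps)
    moreover have "det3 (V (?q - 1)) (V ?q) (V (?q + 1)) = 1"
      using u[of "?q - 1"] by (simp add: algebra_simps)
    ultimately show ?thesis
      using det3_plucker(1)[of "V p" "V (?q - 1)" "V ?q" "V (p + 1)" "V (?q + 1)"]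
      by (simp add: mult.commute)
  next
    case (odd p)
    let ?q = "p + int r + 2"
    have "det_frieze V r c = det3 (V p) (V (?q - 1)) (V ?q)"
      using odd det_frieze_odd[of V r p] by (simp add: algebra_simps)
    moreover have "det_frieze V r (c - 1) = det3 (V (p - 1)) (V p) (V (?q - 1))"
      using odd det_frieze_even[of V r "p - 1"] by (simp add: algebra_simps)
    moreover have "det_frieze V r (c + 1) = det3 (V p) (V (p + 1)) (V ?q)"
      using odd det_frieze_even[of V r p] by (simp add: algebra_simps)
    moreover have "det_frieze V (r - 1) c = det3 (V p) (V (p + 1)) (V (?q - 1))"
      using odd assms(2) det_frieze_even[of V "r - 1" p] by (simp add: algebra_simps)
    moreover have "det_frieze V (r + 1) c = det3 (V (p - 1)) (V p) (V ?q)"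
      using odd det_frieze_even[of V "r + 1" "p - 1"] by (simp add: algebra_simps)
    moreover have "det3 (V (p - 1)) (V p) (V (p + 1)) = 1"
      using u[of "p - 1"] by (simp add: add.commute)
    ultimately show ?thesis
      using det3_plucker(2)[of "V (p - 1)" "V p" "V (?q - 1)" "V (p + 1)" "V ?q"]
      by (simp add: add.commute)
  qed
qed

text \<open>Period k + 4 turns the outer index of a triple in row k + 1 into the one just before the
  others, so the triple is a rotation of three consecutive vectors and the bottom row is 1.\<close>

lemma closed_2_frieze_det_frieze:
  assumes V: "unimodular V" and periodic: "\<And>l. V (l + int k + 4) = V l"
  shows "closed_2_frieze k (\<lambda>r c. det_frieze V r (c + d))"
proof -
  have u: "det3 (V l) (V (l + 1)) (V (l + 2)) = 1" for l
    using V by (simp add: unimodular_def)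
  have "det_frieze V (k + 1) c = 1" for c
  proof (cases rule: det_frieze_cases[of c "k + 1"])
    case (even p)
    then have "det_frieze V (k + 1) c = det3 (V p) (V (p + 1)) (V ((p - 1) + int k + 4))"
      using det_frieze_even[of V "k + 1" p] by (simp add: algebra_simps)
    also have "\<dots> = 1"
      using u[of "p - 1"] by (simp only: periodic) (simp add: det3_rotate[of "V (p - 1)"] add.commute)
    finally show ?thesis .
  next
    case (odd p)
    then have "det_frieze V (k + 1) c = det3 (V p) (V ((p - 2) + int k + 4)) (V ((p - 1) + int k + 4))"
      using det_frieze_odd[of V "k + 1" p] by (simp add: algebra_simps)
    also have "\<dots> = 1"
      using u[of "p - 2"] by (simp only: periodic) (simp add: det3_rotate[of "V p"])
    finally show ?thesis .
  qed
  moreover have "det_frieze V r (c + d) = det_frieze V r (c - 1 + d) * det_frieze V r (c + 1 + d)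
      - det_frieze V (r - 1) (c + d) * det_frieze V (r + 1) (c + d)" if "1 \<le> r" for r c
    using det_frieze_rule[OF V that, of "c + d"] by (simp add: algebra_simps)
  ultimately show ?thesis
    unfolding closed_2_frieze_def using det_frieze_0[OF V] by blast
qed

section \<open>Integral friezes as minors of a recurrent sequence\<close>

fun recurrence_seq ::
  "(nat \<Rightarrow> 'a::comm_ring_1) \<Rightarrow> (nat \<Rightarrow> 'a) \<Rightarrow> (nat \<Rightarrow> 'a) \<Rightarrow> nat \<Rightarrow> 'a" where
  "recurrence_seq \<alpha> \<beta> x 0 = x 0"
| "recurrence_seq \<alpha> \<beta> x (Suc 0) = x 1"
| "recurrence_seq \<alpha> \<beta> x (Suc (Suc 0)) = x 2"
| "recurrence_seq \<alpha> \<beta> x (Suc (Suc (Suc n))) =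
     \<alpha> n * recurrence_seq \<alpha> \<beta> x (Suc (Suc n)) - \<beta> n * recurrence_seq \<alpha> \<beta> x (Suc n)
     + recurrence_seq \<alpha> \<beta> x n"

lemma two_sided_recurrence:
  fixes \<alpha> \<beta> :: "int \<Rightarrow> 'a::comm_ring_1"
  obtains f where "f 0 = x" "f 1 = y" "f 2 = z"
    "\<And>l. f (l + 3) = \<alpha> l * f (l + 2) - \<beta> l * f (l + 1) + f l"
proof
  define F where "F = recurrence_seq (\<lambda>n. \<alpha> (int n)) (\<lambda>n. \<beta> (int n)) (\<lambda>n. if n = 0 then x else if n = 1 then y else z)"
  define B where "B = recurrence_seq (\<lambda>n. \<beta> (- 1 - int n)) (\<lambda>n. \<alpha> (- 1 - int n)) (\<lambda>n. if n = 0 then z else if n = 1 then y else x)"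
  \<comment> \<open>Read backwards, the recurrence has the same shape with \<open>\<alpha>\<close> and \<open>\<beta>\<close> interchanged.\<close>
  define f where "f l = (if l \<ge> 0 then F (nat l) else B (nat (2 - l)))" for l
  have F: "F 0 = x" "F 1 = y" "F 2 = z" and
    F3: "\<And>n. F (n + 3) = \<alpha> (int n) * F (n + 2) - \<beta> (int n) * F (n + 1) + F n"
    by (simp_all add: F_def numeral_2_eq_2 numeral_3_eq_3)
  have B: "B 0 = z" "B 1 = y" "B 2 = x" and
    B3: "\<And>n. B (n + 3) = \<beta> (- 1 - int n) * B (n + 2) - \<alpha> (- 1 - int n) * B (n + 1) + B n"
    by (simp_all add: B_def numeral_2_eq_2 numeral_3_eq_3)
  show "f 0 = x" "f 1 = y" "f 2 = z" using F by (simp_all add: f_def)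
  \<comment> \<open>Both halves agree on 0, 1, 2. For l < 0 all of l, ..., l + 3 are at most 2, so
    the backward half alone yields the recurrence.\<close>
  have f_B: "f l = B (nat (2 - l))" if "l \<le> 2" for l
  proof (cases "l < 0")
    case False
    then have "l = 0 \<or> l = 1 \<or> l = 2" using that by presburger
    then show ?thesis using F B by (auto simp: f_def)
  qed (simp add: f_def)
  show "f (l + 3) = \<alpha> l * f (l + 2) - \<beta> l * f (l + 1) + f l" for l
  proof (cases "l \<ge> 0")
    case True
    then show ?thesis using F3[of "nat l"] by (simp add: f_def nat_add_distrib)
  next
    case False
    define n where "n = nat (- 1 - l)"
    have n: "l = - 1 - int n" using False by (simp add: n_def)
    have "f (l + 3) = B n" "f (l + 2) = B (n + 1)" "f (l + 1) = B (n + 2)" "f l = B (n + 3)"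
      using n by (subst f_B; simp add: nat_add_distrib add.commute)+
    then show ?thesis using B3[of n] n by simp
  qed
qed

text \<open>Expanding the newest vector, only its summand \<open>V l\<close> survives in the
  determinant; it has coefficient 1, and moving it to the front is an even permutation.\<close>

lemma unimodular_recurrence:
  assumes "det3 (V 0) (V 1) (V 2) = 1"
    and rec: "\<And>l i. V (l + 3) i = \<alpha> l * V (l + 2) i - \<beta> l * V (l + 1) i + V l i"
  shows "unimodular V"
proof -
  have step: "det3 (V (l + 1)) (V (l + 2)) (V (l + 3)) = det3 (V l) (V (l + 1)) (V (l + 2))" for l
    by (simp add: det3_def rec algebra_simps)
  have "det3 (V l) (V (l + 1)) (V (l + 2)) = 1" for l
  proof (induction l rule: int_induct[where k = 0])
    case base
    then show ?case using assms(1) by simp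
  next
    case (step1 i)
    then show ?case using step[of i] by (simp add: add.assoc)
  next
    case (step2 i)
    then show ?case using step[of "i - 1"] by (simp add: algebra_simps)
  qed
  then show ?thesis by (simp add: unimodular_def)
qed

lemma integral_closed_2_frieze_rule:
  assumes "integral_closed_2_frieze m a" "1 \<le> r" "r \<le> m"
  shows "a r c = a r (c - 1) * a r (c + 1) - a (r - 1) c * a (r + 1) c"
  using assms unfolding integral_closed_2_frieze_def closed_2_frieze_def by blast

lemma integral_closed_2_frieze_pos:
  assumes "integral_closed_2_frieze m a" "r \<le> m + 1"
  shows "0 < a r c"
  using assms unfolding integral_closed_2_frieze_def by blast

lemma integral_closed_2_frieze_0:
  assumes "integral_closed_2_frieze m a"
  shows "a 0 c = 1"
  using assms unfolding integral_closed_2_frieze_def closed_2_frieze_def by blast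

lemma integral_closed_2_frieze_bottom:
  assumes "integral_closed_2_frieze m a"
  shows "a (m + 1) c = 1"
  using assms unfolding integral_closed_2_frieze_def closed_2_frieze_def by blast

text \<open>Start from the standard basis, with row 1 as coefficients. Rows 0 and 1 then agree, and
  the local rule forces each further row, since the positive entry two rows above can be cancelled.
  The shift \<open>d\<close> lets later proofs choose which column belongs to
  \<open>V 0\<close>.\<close>

lemma integral_closed_2_frieze_as_dets:
  assumes a: "integral_closed_2_frieze m a"
  obtains V :: "int \<Rightarrow> nat \<Rightarrow> int" where "unimodular V"
    and "\<forall>l i. V (l + 3) i = a 1 (d + 2 * l + 3) * V (l + 2) i - a 1 (d + 2 * l + 2) * V (l + 1) i + V l i"
    and "\<forall>r c. r \<le> m + 1 \<longrightarrow> a r (d + c) = det_frieze V r c"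
proof -
  define \<alpha> where "\<alpha> l = a 1 (d + 2 * l + 3)" for l
  define \<beta> where "\<beta> l = a 1 (d + 2 * l + 2)" for l
  have "\<exists>f. f 0 = of_bool (i = 0) \<and> f 1 = of_bool (i = 1) \<and> f 2 = of_bool (i = 2) \<and>
      (\<forall>l. f (l + 3) = \<alpha> l * f (l + 2) - \<beta> l * f (l + 1) + f l)" for i :: nat
    by (rule two_sided_recurrence[where \<alpha> = \<alpha> and \<beta> = \<beta>]) blast
  then obtain f where f: "\<And>i :: nat. f i 0 = of_bool (i = 0)" "\<And>i. f i 1 = of_bool (i = 1)"
    "\<And>i. f i 2 = of_bool (i = 2)"
    "\<And>i l. f i (l + 3) = \<alpha> l * f i (l + 2) - \<beta> l * f i (l + 1) + f i l"
    by metis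
  define V where "V l i = f i l" for l i
  have rec: "V (l + 3) i = \<alpha> l * V (l + 2) i - \<beta> l * V (l + 1) i + V l i" for l i
    by (simp add: V_def f)
  have "det3 (V 0) (V 1) (V 2) = 1"
    by (simp add: det3_def V_def f)
  then have V: "unimodular V"
    using rec by (rule unimodular_recurrence)
  then have u: "det3 (V l) (V (l + 1)) (V (l + 2)) = 1" for l
    by (simp add: unimodular_def)
  have row1: "det_frieze V 1 c = a 1 (d + c)" for c
  proof (cases rule: det_frieze_cases[of c 1])
    case (even p)
    have "det3 (V p) (V (p + 1)) (V (p + 3)) = \<alpha> p * det3 (V p) (V (p + 1)) (V (p + 2))"
      unfolding det3_def rec by algebra
    then show ?thesis
      using even det_frieze_even[of V 1 p] u[of p] by (simp add: \<alpha>_def algebra_simps)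
  next
    case (odd p)
    have "det3 (V p) (V (p + 2)) (V (p + 3)) = \<beta> p * det3 (V p) (V (p + 1)) (V (p + 2))"
      unfolding det3_def rec by algebra
    then show ?thesis
      using odd det_frieze_odd[of V 1 p] u[of p] by (simp add: \<beta>_def algebra_simps)
  qed
  have "a r (d + c) = det_frieze V r c" if "r \<le> m + 1" for r c
    using that
  proof (induction r arbitrary: c rule: less_induct)
    case (less r)
    consider "r = 0" | "r = 1" | n where "r = Suc (Suc n)"
      by (metis One_nat_def not0_implies_Suc)
    then show ?case
    proof cases
      case 1
      then show ?thesis using det_frieze_0[OF V] integral_closed_2_frieze_0[OF a] by simp
    next
      case 2
      then show ?thesis using row1 by simp
    next
      case 3
      have IH: "a r' (d + c') = det_frieze V r' c'" if "r' < r" for r' c'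
        using less that by simp
      have "a n (d + c) * a r (d + c) = a (Suc n) (d + c - 1) * a (Suc n) (d + c + 1) - a (Suc n) (d + c)"
        using integral_closed_2_frieze_rule[OF a, of "Suc n" "d + c"] 3 less.prems by simp
      also have "\<dots> = det_frieze V (Suc n) (c - 1) * det_frieze V (Suc n) (c + 1) - det_frieze V (Suc n) c"
        using IH[of "Suc n" "c - 1"] IH[of "Suc n" "c + 1"] IH[of "Suc n" c] 3
        by (simp add: algebra_simps)
      also have "\<dots> = det_frieze V n c * det_frieze V r c"
        using det_frieze_rule[OF V, of "Suc n" c] 3 by simp
      also have "\<dots> = a n (d + c) * det_frieze V r c"
        using IH[of n c] 3 by simp
      finally show ?thesis
        using integral_closed_2_frieze_pos[OF a, of n "d + c"] 3 less.prems by simp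
    qed
  qed
  with V rec show thesis
    using that unfolding \<alpha>_def \<beta>_def by blast
qed

section \<open>Necessity of the congruences\<close>

lemma integral_closed_2_frieze_reflect:
  assumes "integral_closed_2_frieze m a"
  shows "integral_closed_2_frieze m (\<lambda>r c. a r (- c))"
proof -
  have "a r (- c) = a r (- (c - 1)) * a r (- (c + 1)) - a (r - 1) (- c) * a (r + 1) (- c)"
    if "1 \<le> r" "r \<le> m" for r c
  proof -
    have "- (c - 1) = - c + 1" "- (c + 1) = - c - 1" by simp_all
    then show ?thesis
      using integral_closed_2_frieze_rule[OF assms that, of "- c"] by (metis mult.commute)
  qed
  then show ?thesis
    using assms unfolding integral_closed_2_frieze_def closed_2_frieze_def by blast
qed

text \<open>Fix the last two vectors of the minor and expand along the recurrence linking
  \<open>V 0\<close>, ..., \<open>V 3\<close>. For k = 1 the last minor has a repeated vector and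
  vanishes, whereas truncated subtraction in \<open>k - 2\<close> would give the top row of
  1s.\<close>

lemma diagonal_recurrence:
  assumes a: "integral_closed_2_frieze m a" and k: "1 \<le> k" "k \<le> m"
  shows "a (k + 1) c = a 1 (c - int k) * a k (c + 1) - a 1 (c - int k + 1) * a (k - 1) (c + 2)
    + (if k = 1 then 0 else a (k - 2) (c + 3))"
proof -
  define d where "d = c - int k - 2"
  obtain V :: "int \<Rightarrow> nat \<Rightarrow> int" where "unimodular V" and
    rec[rule_format]: "\<forall>l i. V (l + 3) i = a 1 (d + 2 * l + 3) * V (l + 2) i - a 1 (d + 2 * l + 2) * V (l + 1) i + V l i"
    and dets[rule_format]: "\<forall>r c. r \<le> m + 1 \<longrightarrow> a r (d + c) = det_frieze V r c"
    by (rule integral_closed_2_frieze_as_dets[OF a, where d = d])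
  define D where "D l = det3 (V l) (V (int k + 2)) (V (int k + 3))" for l
  have "a (k + 1) c = D 0"
    using dets[of "k + 1" "int k + 2"] k det_frieze_odd[of V "k + 1" 0]
    by (simp add: D_def d_def algebra_simps)
  moreover have "a k (c + 1) = D 1"
    using dets[of k "int k + 3"] k det_frieze_odd[of V k 1]
    by (simp add: D_def d_def algebra_simps)
  moreover have "a (k - 1) (c + 2) = D 2"
    using dets[of "k - 1" "int k + 4"] k det_frieze_odd[of V "k - 1" 2]
    by (simp add: D_def d_def algebra_simps)
  moreover have "(if k = 1 then 0 else a (k - 2) (c + 3)) = D 3"
  proof (cases "k = 1")
    case True
    then show ?thesis by (simp add: D_def det3_repeated)
  next
    case False
    with k have "2 \<le> k" by simp
    with False show ?thesis
      using dets[of "k - 2" "int k + 5"] k det_frieze_odd[of V "k - 2" 3]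
      by (simp add: D_def d_def algebra_simps)
  qed
  moreover have V3: "V 3 i = a 1 (c - int k + 1) * V 2 i - a 1 (c - int k) * V 1 i + V 0 i" for i
    using rec[of 0 i] by (simp add: d_def algebra_simps)
  moreover have "D 3 = a 1 (c - int k + 1) * D 2 - a 1 (c - int k) * D 1 + D 0"
    unfolding D_def det3_def V3 by algebra
  ultimately show ?thesis by (cases "k = 1") simp_all
qed

text \<open>Solving the local rule for the right neighbour divides by a positive entry and uses the
  row below, so each column further to the right costs one row: the two columns determine a
  triangle.\<close>

lemma agree_right:
  assumes a: "integral_closed_2_frieze m a" and w: "integral_closed_2_frieze n w"
    and k: "k \<le> m" "k \<le> n"
    and eq: "\<And>r. r \<le> k \<Longrightarrow> w r c = a r c" "\<And>r. r \<le> k \<Longrightarrow> w r (c + 1) = a r (c + 1)"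
    and "r + i \<le> k"
  shows "w r (c + 1 + int i) = a r (c + 1 + int i)"
  using \<open>r + i \<le> k\<close>
proof (induction i arbitrary: r rule: less_induct)
  case (less i)
  show ?case
  proof (cases i)
    case 0
    then show ?thesis using less.prems eq(2) by simp
  next
    case (Suc j)
    let ?c = "c + int i"
    show ?thesis
    proof (cases "r = 0")
      case True
      then show ?thesis
        using integral_closed_2_frieze_0[OF a] integral_closed_2_frieze_0[OF w] by simp
    next
      case False
      have mid: "w r' ?c = a r' ?c" if "r' + j \<le> k" for r'
        using less.IH[of j r'] that Suc by (simp add: algebra_simps)
      have left: "w r (?c - 1) = a r (?c - 1)"
      proof (cases j)
        case 0
        then show ?thesis using Suc less.prems eq(1) by simp
      next
        case (Suc j')
        then show ?thesis using less.IH[of j' r] less.prems \<open>i = Suc j\<close> by (simp add: algebra_simps)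
      qed
      have "w r (?c - 1) * w r (?c + 1) = a r (?c - 1) * a r (?c + 1)"
        using integral_closed_2_frieze_rule[OF a, of r ?c] integral_closed_2_frieze_rule[OF w, of r ?c]
          mid[of r] mid[of "r - 1"] mid[of "r + 1"] False less.prems Suc k by simp
      moreover have "0 < a r (?c - 1)"
        using integral_closed_2_frieze_pos[OF a] less.prems k by simp
      ultimately show ?thesis
        using left by (simp add: algebra_simps)
    qed
  qed
qed

lemma agree_left:
  assumes a: "integral_closed_2_frieze m a" and w: "integral_closed_2_frieze n w"
    and k: "k \<le> m" "k \<le> n"
    and eq: "\<And>r. r \<le> k \<Longrightarrow> w r c = a r c" "\<And>r. r \<le> k \<Longrightarrow> w r (c + 1) = a r (c + 1)"
    and "r + i \<le> k"
  shows "w r (c - int i) = a r (c - int i)"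
  using agree_right[OF integral_closed_2_frieze_reflect[OF a] integral_closed_2_frieze_reflect[OF w] k,
      of "- c - 1" r i] eq \<open>r + i \<le> k\<close>
  by (simp add: algebra_simps)

lemma cut_cong_lower_left:
  assumes a: "integral_closed_2_frieze m a" and w: "integral_closed_2_frieze k w"
    and k: "1 \<le> k" "k \<le> m"
    and eq: "\<And>r. r \<le> k \<Longrightarrow> w r c = a r c" "\<And>r. r \<le> k \<Longrightarrow> w r (c + 1) = a r (c + 1)"
  shows "[a (k + 1) c = 1] (mod a k (c + 1))"
proof -
  note right = agree_right[OF a w k(2) order_refl eq]
  note left = agree_left[OF a w k(2) order_refl eq]
  have "w 1 (c - int k + 1) = a 1 (c - int k + 1)"
    using left[of 1 "k - 1"] k by (simp add: algebra_simps)
  moreover have "w (k - 1) (c + 2) = a (k - 1) (c + 2)"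
    using right[of "k - 1" 1] k by (simp add: add.commute)
  moreover have "w (k - 2) (c + 3) = a (k - 2) (c + 3)" if "k \<noteq> 1"
    using right[of "k - 2" 2] k that by (simp add: add.commute)
  moreover have "w k (c + 1) = a k (c + 1)" using eq by simp
  \<comment> \<open>Of the entries in the two expansions, only those in row 1 and column
    \<open>c - int k\<close> lie outside the triangles of agreement; their factor is
    \<open>a k (c + 1)\<close>.\<close>
  ultimately have "a (k + 1) c - w (k + 1) c = (a 1 (c - int k) - w 1 (c - int k)) * a k (c + 1)"
    using diagonal_recurrence[OF a k, of c] diagonal_recurrence[OF w k(1) order_refl, of c]
    by (cases "k = 1") (simp_all add: algebra_simps)
  then show ?thesis
    using integral_closed_2_frieze_bottom[OF w] by (simp add: cong_iff_dvd_diff)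
qed

section \<open>Sufficiency: construction of the cut frieze\<close>

lemma positive_2_frieze:
  fixes w :: "nat \<Rightarrow> int \<Rightarrow> 'a::linordered_idom"
  assumes w: "closed_2_frieze k w"
    and pos: "\<And>r. r \<le> k + 1 \<Longrightarrow> 0 < w r c" "\<And>r. r \<le> k + 1 \<Longrightarrow> 0 < w r (c + 1)"
    and "r \<le> k + 1"
  shows "0 < w r e"
proof -
  have top: "w 0 b = 1" "w (k + 1) b = 1" for b
    using w unfolding closed_2_frieze_def by blast+
  have prod: "0 < w r (b - 1) * w r (b + 1)"
    if "\<And>r. r \<le> k + 1 \<Longrightarrow> 0 < w r b" "1 \<le> r" "r \<le> k" for r b
  proof -
    have "w r (b - 1) * w r (b + 1) = w r b + w (r - 1) b * w (r + 1) b"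
      using w that(2,3) unfolding closed_2_frieze_def by (metis diff_add_cancel)
    then show ?thesis using that by (simp add: add_pos_pos)
  qed
  \<comment> \<open>Next to a positive column the product of the left and right neighbours is a sum
    of positive terms, so these neighbours have the same sign.\<close>
  have step: "0 < w r (b - 1) \<longleftrightarrow> 0 < w r (b + 1)"
    if "\<And>r. r \<le> k + 1 \<Longrightarrow> 0 < w r b" "r \<le> k + 1" for r b
  proof (cases "1 \<le> r \<and> r \<le> k")
    case True
    then show ?thesis using prod[of b r, OF that(1)] by (auto simp: zero_less_mult_iff)
  next
    case False
    then have "r = 0 \<or> r = k + 1" using that(2) by auto
    then show ?thesis using top by auto
  qed
  have "\<forall>r\<le>k + 1. 0 < w r e \<and> 0 < w r (e + 1)" for e
  proof (induction e rule: int_induct[where k = c])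
    case base
    then show ?case using pos by simp
  next
    case (step1 i)
    then show ?case using step[of "i + 1"] by (simp add: algebra_simps)
  next
    case (step2 i)
    then show ?case using step[of i] by simp
  qed
  then show ?thesis using \<open>r \<le> k + 1\<close> by simp
qed

lemma cut_exists:
  assumes a: "integral_closed_2_frieze m a" and k: "1 \<le> k" "k \<le> m"
    and u: "[a (k + 1) c = 1] (mod a k (c + 1))" and v: "[a (k + 1) (c + 1) = 1] (mod a k c)"
  obtains w where "integral_closed_2_frieze k w"
    "\<And>r. r \<le> k \<Longrightarrow> w r c = a r c" "\<And>r. r \<le> k \<Longrightarrow> w r (c + 1) = a r (c + 1)"
proof -
  from u obtain t where t: "a (k + 1) c + t * a k (c + 1) = 1"
    by (metis cong_iff_lin mult.commute)
  from v obtain s where s: "a (k + 1) (c + 1) + s * a k c = 1"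
    by (metis cong_iff_lin mult.commute)
  define d where "d = c - int k - 2"
  obtain V :: "int \<Rightarrow> nat \<Rightarrow> int" where V: "unimodular V"
    and "\<forall>l i. V (l + 3) i = a 1 (d + 2 * l + 3) * V (l + 2) i - a 1 (d + 2 * l + 2) * V (l + 1) i + V l i"
    and dets[rule_format]: "\<forall>r c. r \<le> m + 1 \<longrightarrow> a r (d + c) = det_frieze V r c"
    by (rule integral_closed_2_frieze_as_dets[OF a, where d = d])
  have x: "a k c = det3 (V 0) (V 1) (V (int k + 2))"
    using dets[of k "int k + 2"] k det_frieze_even[of V k 0] by (simp add: d_def)
  have y: "a k (c + 1) = det3 (V 1) (V (int k + 2)) (V (int k + 3))"
    using dets[of k "int k + 3"] k det_frieze_odd[of V k 1] by (simp add: d_def algebra_simps)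
  have u': "a (k + 1) c = det3 (V 0) (V (int k + 2)) (V (int k + 3))"
    using dets[of "k + 1" "int k + 2"] k det_frieze_odd[of V "k + 1" 0] by (simp add: d_def algebra_simps)
  have v': "a (k + 1) (c + 1) = det3 (V 0) (V 1) (V (int k + 3))"
    using dets[of "k + 1" "int k + 3"] k det_frieze_even[of V "k + 1" 0] by (simp add: d_def algebra_simps)
  define U where "U = V (0 := \<lambda>i. V 0 i + t * V 1 i,
    int k + 3 := \<lambda>i. V (int k + 3) i + s * V (int k + 2) i)"
  define W where "W l = U (l mod (int k + 4))" for l
  have U0: "U 0 = (\<lambda>i. V 0 i + t * V 1 i)" by (simp add: U_def)
  have U_last: "U (int k + 3) = (\<lambda>i. V (int k + 3) i + s * V (int k + 2) i)" by (simp add: U_def)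
  have U_V: "U l = V l" if "l \<noteq> 0" "l \<noteq> int k + 3" for l using that by (simp add: U_def)
  have one: "det3 (V l) (V (l + 1)) (V (l + 2)) = 1" for l
    using V by (simp add: unimodular_def)
  have W_U: "W l = U l" if "0 \<le> l" "l \<le> int k + 3" for l
    using that by (simp add: W_def)
  have W_V: "W l = V l" if "1 \<le> l" "l \<le> int k + 2" for l
    using that by (simp add: W_U U_V)
  have periodic: "W (l + int k + 4) = W l" for l
    by (simp add: W_def add.assoc)
  have small: "det3 (W l) (W (l + 1)) (W (l + 2)) = 1" if "0 \<le> l" "l < int k + 4" for l
  proof -
    \<comment> \<open>Windows at 0 and k + 1 contain one changed vector together with the one whose
      multiple was added, so their determinants stay 1. The windows at k + 2 and k + 3 cross the
      seam and give u + t y and v + s x.\<close>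
    have "l = 0 \<or> 1 \<le> l \<and> l \<le> int k \<or> l = int k + 1 \<or> l = int k + 2 \<or> l = int k + 3"
      using that by auto
    then consider "l = 0" | "1 \<le> l" "l \<le> int k" | "l = int k + 1" | "l = int k + 2" | "l = int k + 3"
      by blast
    then show ?thesis
    proof cases
      case 1
      have "det3 (W 0) (W 1) (W 2) = det3 (V 0) (V 1) (V 2)"
        using k by (simp add: W_V) (simp add: W_U U0 det3_def algebra_simps)
      with 1 show ?thesis using one[of 0] by simp
    next
      case 2
      then show ?thesis using one[of l] by (simp add: W_V)
    next
      case 3
      have "det3 (W l) (W (l + 1)) (W (l + 2)) = det3 (V l) (V (l + 1)) (V (l + 2))"
        using k 3 by (simp add: W_V) (simp add: W_U U_last det3_def algebra_simps)
      then show ?thesis using one[of l] by simp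
    next
      case 4
      have "W (l + 2) = W 0" using periodic[of 0] 4 by (simp add: add.commute)
      then have "det3 (W l) (W (l + 1)) (W (l + 2)) =
          det3 (V (int k + 2)) (U (int k + 3)) (U 0)"
        using 4 by (simp add: W_V W_U add.commute)
      also have "\<dots> = a (k + 1) c + t * a k (c + 1)"
        unfolding u' y U_last U0 det3_def by algebra
      finally show ?thesis using t by simp
    next
      case 5
      have "W (l + 1) = W 0" "W (l + 2) = W 1" using periodic[of 0] periodic[of 1] 5
        by (simp_all add: algebra_simps)
      then have "det3 (W l) (W (l + 1)) (W (l + 2)) = det3 (U (int k + 3)) (U 0) (V 1)"
        using 5 k by (simp add: W_V W_U)
      also have "\<dots> = a (k + 1) (c + 1) + s * a k c"
        unfolding v' x U_last U0 det3_def by algebra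
      finally show ?thesis using s by simp
    qed
  qed
  have uni: "unimodular W"
    unfolding unimodular_def
  proof
    fix l
    have "W (l mod (int k + 4) + j) = W (l + j)" for j
      by (simp add: W_def mod_simps)
    from this[of 0] this[of 1] this[of 2] show "det3 (W l) (W (l + 1)) (W (l + 2)) = 1"
      using small[of "l mod (int k + 4)"] by simp
  qed
  define w where "w r e = det_frieze W r (e + - d)" for r e
  have closed: "closed_2_frieze k w"
    unfolding w_def by (rule closed_2_frieze_det_frieze[OF uni periodic])
  have eq0: "w r c = a r c" if "r \<le> k" for r
  proof (cases "r = k")
    case True
    have "det3 (W 0) (W 1) (W (int k + 2)) = a k c"
      unfolding x using k by (simp add: W_V) (simp add: W_U U0 det3_def algebra_simps)
    then show ?thesis using det_frieze_even[of W k 0] True by (simp add: w_def d_def add.commute)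
  next
    case False
    let ?p = "(int k + 2 - int r - 1) div 2"
    \<comment> \<open>Above row k only vectors with indices from 1 to k + 2 occur, and these are
      unchanged. In row k the changed vector again appears beside the one that was added to
      it.\<close>
    have p: "1 \<le> ?p" "?p + int r + 2 \<le> int k + 2" using False that by linarith+
    have "w r c = det_frieze V r (int k + 2)"
      using p by (simp add: w_def d_def det_frieze_def Let_def W_V add.commute)
    then show ?thesis using dets[of r "int k + 2"] that k by (simp add: d_def)
  qed
  have eq1: "w r (c + 1) = a r (c + 1)" if "r \<le> k" for r
  proof (cases "r = k")
    case True
    have "det3 (W 1) (W (int k + 2)) (W (int k + 3)) = a k (c + 1)"
      unfolding y using k by (simp add: W_V) (simp add: W_U U_last det3_def algebra_simps)
    then show ?thesis using det_frieze_odd[of W k 1] True by (simp add: w_def d_def algebra_simps)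
  next
    case False
    let ?p = "(int k + 3 - int r - 1) div 2"
    have p: "1 \<le> ?p" "?p + int r + 2 \<le> int k + 2" using False that by linarith+
    have "w r (c + 1) = det_frieze V r (int k + 3)"
      using p by (simp add: w_def d_def det_frieze_def Let_def W_V add.commute)
    then show ?thesis using dets[of r "int k + 3"] that k by (simp add: d_def)
  qed
  have bottom: "w (k + 1) e = 1" for e
    using closed unfolding closed_2_frieze_def by blast
  have "0 < w r c" "0 < w r (c + 1)" if "r \<le> k + 1" for r
    using eq0[of r] eq1[of r] bottom integral_closed_2_frieze_pos[OF a, of r] that k
    by (cases "r = k + 1"; simp)+
  then have "integral_closed_2_frieze k w"
    unfolding integral_closed_2_frieze_def using closed positive_2_frieze[OF closed] by blast
  then show thesis using eq0 eq1 by (rule that)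
qed

theorem theorem3:
  fixes a :: "nat \<Rightarrow> int \<Rightarrow> int" and m k :: nat and c x y u v :: int
  assumes "integral_closed_2_frieze m a"
    and "1 \<le> k" and "k \<le> m"
    and "x = a k c" and "y = a k (c + 1)"
    and "u = a (k + 1) c" and "v = a (k + 1) (c + 1)"
  shows "(\<exists>w. integral_closed_2_frieze k w \<and>
            (\<forall>r\<le>k. \<forall>\<epsilon>\<in>{0, 1}. w r (c + \<epsilon>) = a r (c + \<epsilon>)))
         \<longleftrightarrow> [u = 1] (mod y) \<and> [v = 1] (mod x)"
proof
  assume "\<exists>w. integral_closed_2_frieze k w \<and> (\<forall>r\<le>k. \<forall>\<epsilon>\<in>{0, 1}. w r (c + \<epsilon>) = a r (c + \<epsilon>))"
  then obtain w where w: "integral_closed_2_frieze k w"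
    and eq: "\<And>r. r \<le> k \<Longrightarrow> w r c = a r c" "\<And>r. r \<le> k \<Longrightarrow> w r (c + 1) = a r (c + 1)"
    by auto
  \<comment> \<open>Reflection exchanges the two columns when the base column is
    \<open>- c - 1\<close>, so v and x take the places of u and y.\<close>
  have "[v = 1] (mod x)"
    using cut_cong_lower_left[OF integral_closed_2_frieze_reflect integral_closed_2_frieze_reflect,
        OF assms(1) w assms(2,3), of "- c - 1"] eq assms
    by (simp add: algebra_simps)
  with cut_cong_lower_left[OF assms(1) w assms(2,3) eq] show "[u = 1] (mod y) \<and> [v = 1] (mod x)"
    using assms by simp
next
  assume "[u = 1] (mod y) \<and> [v = 1] (mod x)"
  then obtain w where "integral_closed_2_frieze k w"
    "\<And>r. r \<le> k \<Longrightarrow> w r c = a r c" "\<And>r. r \<le> k \<Longrightarrow> w r (c + 1) = a r (c + 1)"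
    using cut_exists[OF assms(1-3)] assms(4-) by metis
  then show "\<exists>w. integral_closed_2_frieze k w \<and> (\<forall>r\<le>k. \<forall>\<epsilon>\<in>{0, 1}. w r (c + \<epsilon>) = a r (c + \<epsilon>))"
    by auto
qed

end
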